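(* Let $\{(y_i,\mathbf{x}_i)\}_{i=1}^{\infty}$ be an i.i.d. sequence, where $y_i$ takes only the values $0$ and $1$ and $\mathbf{x}_i$ is a $1\times K$ random row vector. Let $R:\mathbb{R}\to[0,1]$ be the ramp function, $R(z)=0$ for $z\le 0$, $R(z)=z$ for $0<z<1$, $R(z)=1$ for $z\ge 1$. Let $\mathcal{B}\subset\mathbb{R}^K$ be compact, and suppose $\boldsymbol{\beta}_o\in\mathcal{B}$ satisfies, for all $\boldsymbol{\beta}\in\mathcal{B}$ with $\boldsymbol{\beta}\neq\boldsymbol{\beta}_o$, $$E\left[\left(y_i-R(\mathbf{x}_i\boldsymbol{\beta}_o)\right)^2\right]<E\left[\left(y_i-R(\mathbf{x}_i\boldsymbol{\beta})\right)^2\right].$$ Let $\hat{\boldsymbol{\beta}}=\hat{\boldsymbol{\beta}}_N$ be a minimizer over $\boldsymbol{\beta}\in\mathcal{B}$ of $Q_N(\boldsymbol{\beta})=\frac1N\sum_{i=1}^N(y_i-R(\mathbf{x}_i\boldsymbol{\beta}))^2$. Suppose further that (i) $\boldsymbol{\beta}_o$ is an interior point of $\mathcal{B}$; (ii) $\mathbf{x}_i$ contains a continuously distributed random variable $x_{ij}$ whose coefficient $\beta_{jo}$ in $\boldsymbol{\beta}_o$ is nonzero, and $\mathbf{x}_i\boldsymbol{\beta}_o$ is continuously distributed, so that $P(\mathbf{x}_i\boldsymbol{\beta}_o=0)=P(\mathbf{x}_i\boldsymbol{\beta}_o=1)=0$; (iii) $E\|\mathbf{x}_i\|^2<\infty$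 and the matrix $E\left[\mathbf{x}_i'\mathbf{x}_i\,1\{\mathbf{x}_i\boldsymbol{\beta}_o\in(0,1)\}\right]$ is positive definite, where $\|\cdot\|$ is the $\ell^2$-norm; (iv) $E\|\mathbf{x}_i\|^4<\infty$. Define $$\mathbf{A}(\boldsymbol{\beta}_o)=E\left[\mathbf{x}_i'\mathbf{x}_i\,1\{\mathbf{x}_i\boldsymbol{\beta}_o\in(0,1)\}\right],\qquad \mathbf{\Omega}(\boldsymbol{\beta}_o)=E\left[\mathbf{x}_i'\mathbf{x}_i\,\left(y_i-R(\mathbf{x}_i\boldsymbol{\beta}_o)\right)^2\,1\{\mathbf{x}_i\boldsymbol{\beta}_o\in(0,1)\}\right],$$ $$\mathbf{A}_N(\hat{\boldsymbol{\beta}})=\frac1N\sum_{i=1}^N\mathbf{x}_i'\mathbf{x}_i\,1\{\mathbf{x}_i\hat{\boldsymbol{\beta}}\in(0,1)\},\qquad \mathbf{\Omega}_N(\hat{\boldsymbol{\beta}})=\frac1N\sum_{i=1}^N\mathbf{x}_i'\mathbf{x}_i\,\left(y_i-R(\mathbf{x}_i\hat{\boldsymbol{\beta}})\right)^2\,1\{\mathbf{x}_i\hat{\boldsymbol{\beta}}\in(0,1)\},$$ and $\hat{\mathbf{V}}=\mathbf{A}_N(\hat{\boldsymbol{\beta}})^{-1}\,\mathbf{\Omega}_N(\hat{\boldsymbol{\beta}})\,\mathbf{A}_N(\hat{\boldsymbol{\beta}})^{-1}$. Then, as $N\to\infty$, $$\hat{\mathbf{V}}\overset{p}{\to}\ma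thbf{A}(\boldsymbol{\beta}_o)^{-1}\,\mathbf{\Omega}(\boldsymbol{\beta}_o)\,\mathbf{A}(\boldsymbol{\beta}_o)^{-1}.$$
   Context: Vectors $\boldsymbol{\beta}\in\mathbb{R}^K$ are column vectors, so $\mathbf{x}_i\boldsymbol{\beta}$ is a scalar and $\mathbf{x}_i'\mathbf{x}_i$ is a $K\times K$ matrix; the first entry of $\mathbf{x}_i$ is the constant $1$ (an intercept). $1\{\cdot\}$ is the indicator function. It is not assumed that $E[y_i\mid\mathbf{x}_i]=R(\mathbf{x}_i\boldsymbol{\beta})$ for some $\boldsymbol{\beta}$ (the conditional mean model may be misspecified); $\boldsymbol{\beta}_o$ is the pseudo-true value, the unique minimizer of $E[(y_i-R(\mathbf{x}_i\boldsymbol{\beta}))^2]$ over $\mathcal{B}$. The estimator $\hat{\boldsymbol{\beta}}$ is understood as a (measurable) choice of minimizer of $Q_N$ for each $N$. On the event that $\mathbf{A}_N(\hat{\boldsymbol{\beta}})$ is singular, $\hat{\mathbf{V}}$ may be defined arbitrarily. *)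

theory Defs
  imports "HOL-Probability.Probability"
begin

definition iid_seq :: "'a measure \<Rightarrow> (nat \<Rightarrow> 'a \<Rightarrow> 'b::topological_space) \<Rightarrow> bool" where
  "iid_seq M Z \<longleftrightarrow>
     prob_space.indep_vars M (\<lambda>_. borel) Z UNIV \<and>
     (\<forall>i. distr M borel (Z i) = distr M borel (Z 0))"

(* Continuity of the distribution function, i.e. absence of atoms; a Lebesgue density is a
   special case. *)
definition continuously_distributed :: "'a measure \<Rightarrow> ('a \<Rightarrow> real) \<Rightarrow> bool" where
  "continuously_distributed M X \<longleftrightarrow> continuous_on UNIV (cdf (distr M borel X))"

definition converges_in_prob ::
  "'a measure \<Rightarrow> (nat \<Rightarrow> 'a \<Rightarrow> 'b::metric_space) \<Rightarrow> 'b \<Rightarrow> bool" where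
  "converges_in_prob M X c \<longleftrightarrow>
     (\<forall>\<epsilon>>0. (\<lambda>N. measure M {\<omega> \<in> space M. dist (X N \<omega>) c > \<epsilon>}) \<longlonglongrightarrow> 0)"

definition pos_definite :: "real ^ 'k ^ 'k \<Rightarrow> bool" where
  "pos_definite A \<longleftrightarrow> transpose A = A \<and> (\<forall>v. v \<noteq> 0 \<longrightarrow> v \<bullet> (A *v v) > 0)"

definition ramp :: "real \<Rightarrow> real" where
  "ramp z = (if z \<le> 0 then 0 else if z < 1 then z else 1)"

(* The K x K matrix x'x of a row vector x. The scalar x b is written as the inner product. *)
definition gram :: "real ^ 'k \<Rightarrow> real ^ 'k ^ 'k" where
  "gram x = (\<chi> a b. x $ a * x $ b)"

definition A_summand :: "real ^ 'k \<Rightarrow> real ^ 'k \<Rightarrow> real ^ 'k ^ 'k" where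
  "A_summand x \<beta> = indicat_real {0<..<1} (x \<bullet> \<beta>) *\<^sub>R gram x"

definition Omega_summand :: "real \<Rightarrow> real ^ 'k \<Rightarrow> real ^ 'k \<Rightarrow> real ^ 'k ^ 'k" where
  "Omega_summand y x \<beta> =
     ((y - ramp (x \<bullet> \<beta>))\<^sup>2 * indicat_real {0<..<1} (x \<bullet> \<beta>)) *\<^sub>R gram x"

(* Population quantities; Y and X are a single response and regressor vector. *)

definition Q_pop :: "'a measure \<Rightarrow> ('a \<Rightarrow> real) \<Rightarrow> ('a \<Rightarrow> real ^ 'k) \<Rightarrow> real ^ 'k \<Rightarrow> real" where
  "Q_pop M Y X \<beta> = (\<integral>\<omega>. (Y \<omega> - ramp (X \<omega> \<bullet> \<beta>))\<^sup>2 \<partial>M)"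

definition A_pop :: "'a measure \<Rightarrow> ('a \<Rightarrow> real ^ 'k) \<Rightarrow> real ^ 'k \<Rightarrow> real ^ 'k ^ 'k" where
  "A_pop M X \<beta> = (\<integral>\<omega>. A_summand (X \<omega>) \<beta> \<partial>M)"

definition Omega_pop ::
  "'a measure \<Rightarrow> ('a \<Rightarrow> real) \<Rightarrow> ('a \<Rightarrow> real ^ 'k) \<Rightarrow> real ^ 'k \<Rightarrow> real ^ 'k ^ 'k" where
  "Omega_pop M Y X \<beta> = (\<integral>\<omega>. Omega_summand (Y \<omega>) (X \<omega>) \<beta> \<partial>M)"

(* Sample averages. The sequence is indexed from 0, so the first N observations are i < N. *)

definition Q_sample ::
  "(nat \<Rightarrow> 'a \<Rightarrow> real) \<Rightarrow> (nat \<Rightarrow> 'a \<Rightarrow> real ^ 'k) \<Rightarrow> nat \<Rightarrow> 'a \<Rightarrow> real ^ 'k \<Rightarrow> real" where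
  "Q_sample y x N \<omega> \<beta> = (1 / real N) * (\<Sum>i<N. (y i \<omega> - ramp (x i \<omega> \<bullet> \<beta>))\<^sup>2)"

definition A_sample ::
  "(nat \<Rightarrow> 'a \<Rightarrow> real ^ 'k) \<Rightarrow> nat \<Rightarrow> 'a \<Rightarrow> real ^ 'k \<Rightarrow> real ^ 'k ^ 'k" where
  "A_sample x N \<omega> \<beta> = (1 / real N) *\<^sub>R (\<Sum>i<N. A_summand (x i \<omega>) \<beta>)"

definition Omega_sample ::
  "(nat \<Rightarrow> 'a \<Rightarrow> real) \<Rightarrow> (nat \<Rightarrow> 'a \<Rightarrow> real ^ 'k) \<Rightarrow> nat \<Rightarrow> 'a \<Rightarrow> real ^ 'k \<Rightarrow> real ^ 'k ^ 'k" where
  "Omega_sample y x N \<omega> \<beta> = (1 / real N) *\<^sub>R (\<Sum>i<N. Omega_summand (y i \<omega>) (x i \<omega>) \<beta>)"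

(* Meaningful only for invertible A, as matrix_inv is unspecified otherwise. *)
definition sandwich :: "real ^ 'k ^ 'k \<Rightarrow> real ^ 'k ^ 'k \<Rightarrow> real ^ 'k ^ 'k" where
  "sandwich A \<Omega> = matrix_inv A ** \<Omega> ** matrix_inv A"

end

theory Submission
  imports Defs
begin

text \<open>
  Since fourth moments are finite, every sample average occurring here obeys a weak law of large
  numbers by Chebyshev's inequality. The squared residual is Lipschitz in the coefficient vector,
  with a constant proportional to \<open>norm x\<close>; compactness then upgrades the pointwise law to
  consistency of the minimizer. The summands of \<open>A\<close> and \<open>\<Omega>\<close> are discontinuous in the coefficient
  vector, but only where the index \<open>x \<bullet> \<beta>\<close> meets \<open>0\<close> or \<open>1\<close>: within distance \<open>d\<close> of \<open>\<beta>\<^sub>o\<close> their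
  oscillation is dominated by a function of the data whose mean tends to \<open>0\<close> with \<open>d\<close>, because the
  index at \<open>\<beta>\<^sub>o\<close> has no atom at \<open>0\<close> or \<open>1\<close>. So the estimator may be plugged into the sample averages,
  and the sandwich is continuous at the population pair.
\<close>

subsection \<open>Convergence in probability as convergence along a filter\<close>

text \<open>
  A property of (sample size, outcome) holds eventually along \<open>whp M\<close> if it fails only on events
  of vanishing probability. Limits along this filter are limits in outer probability, so the
  continuous mapping theorem is the usual calculus of limits, and no measurability of the
  composed statistics is needed.
\<close>

definition whp :: "'a measure \<Rightarrow> (nat \<times> 'a) filter" where
  "whp M = Abs_filter (\<lambda>P. \<exists>G. (\<forall>N. G N \<in> sets M) \<and> (\<lambda>N. measure M (G N)) \<longlonglongrightarrow> 0 \<and>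
     (\<forall>\<^sub>F N in sequentially. \<forall>\<omega>\<in>space M - G N. P (N, \<omega>)))"

text \<open>\<open>Abs_filter\<close> has its intended meaning only for a genuine filter. Closure
  under conjunction is the point: exceptional events are united, and subadditivity keeps their
  probabilities vanishing.\<close>

lemma eventually_whp:
  "eventually P (whp M) \<longleftrightarrow> (\<exists>G. (\<forall>N. G N \<in> sets M) \<and> (\<lambda>N. measure M (G N)) \<longlonglongrightarrow> 0 \<and>
     (\<forall>\<^sub>F N in sequentially. \<forall>\<omega>\<in>space M - G N. P (N, \<omega>)))"
  unfolding whp_def
proof (rule eventually_Abs_filter, rule is_filter.intro, goal_cases)
  case 1
  show ?case by (rule exI[of _ "\<lambda>_. {}"]) auto
next
  case (2 P Q)
  then obtain G H where G: "\<forall>N. G N \<in> sets M" "(\<lambda>N. measure M (G N)) \<longlonglongrightarrow> 0"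
      "\<forall>\<^sub>F N in sequentially. \<forall>\<omega>\<in>space M - G N. P (N, \<omega>)"
    and H: "\<forall>N. H N \<in> sets M" "(\<lambda>N. measure M (H N)) \<longlonglongrightarrow> 0"
      "\<forall>\<^sub>F N in sequentially. \<forall>\<omega>\<in>space M - H N. Q (N, \<omega>)"
    by blast
  have "(\<lambda>N. measure M (G N \<union> H N)) \<longlonglongrightarrow> 0"
  proof (rule tendsto_sandwich[of "\<lambda>_. 0"])
    show "(\<lambda>N. measure M (G N) + measure M (H N)) \<longlonglongrightarrow> 0"
      using tendsto_add[OF G(2) H(2)] by simp
    show "\<forall>\<^sub>F N in sequentially.
        measure M (G N \<union> H N) \<le> measure M (G N) + measure M (H N)"
      using G(1) H(1) by (auto intro!: always_eventually measure_Un_le)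
  qed auto
  moreover have "\<forall>\<^sub>F N in sequentially. \<forall>\<omega>\<in>space M - (G N \<union> H N). P (N, \<omega>) \<and> Q (N, \<omega>)"
    using G(3) H(3) by eventually_elim auto
  ultimately show ?case
    using G(1) H(1) by (intro exI[of _ "\<lambda>N. G N \<union> H N"]) auto
next
  case (3 P Q)
  then obtain G where G: "\<forall>N. G N \<in> sets M" "(\<lambda>N. measure M (G N)) \<longlonglongrightarrow> 0"
      "\<forall>\<^sub>F N in sequentially. \<forall>\<omega>\<in>space M - G N. P (N, \<omega>)"
    by blast
  have "\<forall>\<^sub>F N in sequentially. \<forall>\<omega>\<in>space M - G N. Q (N, \<omega>)"
    using G(3) by eventually_elim (use 3 in auto)
  with G show ?case by blast
qed

text \<open>Supplies the side conditions under which facts about individual samples may be used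
  inside an \<open>eventually_elim\<close>.\<close>

lemma eventually_whp_space: "\<forall>\<^sub>F p in whp M. fst p > 0 \<and> snd p \<in> space M"
  unfolding eventually_whp
  by (intro exI[of _ "\<lambda>_. {}"]) (auto intro: eventually_mono[OF eventually_gt_at_top[of 0]])

text \<open>For large \<open>N\<close> the deviation event lies inside the exceptional event, whose
  probability vanishes. This is the way back from filter limits to the classical notion.\<close>

lemma (in finite_measure) converges_in_prob_if_tendsto_whp:
  assumes "((\<lambda>p. X (fst p) (snd p)) \<longlongrightarrow> c) (whp M)"
  shows "converges_in_prob M X c"
  unfolding converges_in_prob_def
proof (intro allI impI)
  fix \<epsilon> :: real assume "\<epsilon> > 0"
  with assms have "\<forall>\<^sub>F p in whp M. dist (X (fst p) (snd p)) c < \<epsilon>"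
    by (rule tendstoD)
  then obtain G where G: "\<forall>N. G N \<in> sets M" "(\<lambda>N. measure M (G N)) \<longlonglongrightarrow> 0"
      "\<forall>\<^sub>F N in sequentially. \<forall>\<omega>\<in>space M - G N. dist (X N \<omega>) c < \<epsilon>"
    unfolding eventually_whp by auto
  show "(\<lambda>N. measure M {\<omega> \<in> space M. dist (X N \<omega>) c > \<epsilon>}) \<longlonglongrightarrow> 0"
  proof (rule tendsto_sandwich[OF _ _ tendsto_const G(2)])
    show "\<forall>\<^sub>F N in sequentially. measure M {\<omega> \<in> space M. dist (X N \<omega>) c > \<epsilon>} \<le> measure M (G N)"
      using G(3)
    proof eventually_elim
      case (elim N)
      then have "{\<omega> \<in> space M. dist (X N \<omega>) c > \<epsilon>} \<subseteq> G N" by force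
      then show ?case using G(1) by (intro finite_measure_mono) auto
    qed
  qed auto
qed

subsection \<open>Sample means and plug-in estimators\<close>

text \<open>Sample size and outcome form one argument, so that limits along \<open>whp M\<close> can
  be taken. The function \<open>f\<close> may itself depend on that argument, which is how an
  estimated parameter is plugged in.\<close>

definition sample_mean ::
  "(nat \<Rightarrow> 'a \<Rightarrow> 'b) \<Rightarrow> ('b \<Rightarrow> 'c::real_vector) \<Rightarrow> nat \<times> 'a \<Rightarrow> 'c" where
  "sample_mean Z f p = (1 / real (fst p)) *\<^sub>R (\<Sum>i<fst p. f (Z i (snd p)))"

lemma sample_mean_diff:
  "sample_mean Z (\<lambda>z. f z - g z) p = sample_mean Z f p - sample_mean Z g p"
  by (simp add: sample_mean_def sum_subtractf scaleR_diff_right)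

lemma norm_sample_mean_le:
  fixes f :: "'b \<Rightarrow> 'c::real_normed_vector"
  assumes "\<And>i. norm (f (Z i (snd p))) \<le> g (Z i (snd p))"
  shows "norm (sample_mean Z f p) \<le> sample_mean Z g p"
proof -
  have "norm (\<Sum>i<fst p. f (Z i (snd p))) \<le> (\<Sum>i<fst p. g (Z i (snd p)))"
    by (intro sum_norm_le assms)
  then show ?thesis
    by (simp add: sample_mean_def divide_right_mono)
qed

lemma (in prob_space)
  fixes Z :: "nat \<Rightarrow> 'a \<Rightarrow> 'b::topological_space"
  assumes "iid_seq M Z"
  shows iid_seq_measurable: "Z i \<in> borel_measurable M"
    and iid_seq_distr: "distr M borel (Z i) = distr M borel (Z 0)"
    and iid_seq_indep: "indep_vars (\<lambda>_. borel) Z UNIV"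
  using assms unfolding iid_seq_def indep_vars_def by auto

lemma (in prob_space) iid_seq_integral_eq:
  fixes f :: "'b::topological_space \<Rightarrow> 'c::{banach, second_countable_topology}"
  assumes "iid_seq M Z" and "f \<in> borel_measurable borel"
  shows "(\<integral>\<omega>. f (Z i \<omega>) \<partial>M) = (\<integral>\<omega>. f (Z 0 \<omega>) \<partial>M)"
    and "integrable M (\<lambda>\<omega>. f (Z i \<omega>)) \<longleftrightarrow> integrable M (\<lambda>\<omega>. f (Z 0 \<omega>))"
  using iid_seq_measurable[OF assms(1), of i] iid_seq_measurable[OF assms(1), of 0]
    iid_seq_distr[OF assms(1), of i] assms(2)
  by (simp_all flip: integral_distr integrable_distr_eq)

text \<open>Chebyshev's inequality: the centred sum of \<open>N\<close> terms has variance
  \<open>N * v\<close>, so a deviation of order \<open>N\<close> has probability of order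
  \<open>1 / N\<close>.\<close>

lemma (in prob_space) sample_mean_tendsto_real:
  fixes f :: "'b::topological_space \<Rightarrow> real"
  assumes iid: "iid_seq M Z" and f[measurable]: "f \<in> borel_measurable borel"
    and sq: "integrable M (\<lambda>\<omega>. (f (Z 0 \<omega>))\<^sup>2)"
  shows "(sample_mean Z f \<longlongrightarrow> expectation (\<lambda>\<omega>. f (Z 0 \<omega>))) (whp M)"
proof (rule tendstoI)
  fix \<epsilon> :: real assume \<epsilon>: "\<epsilon> > 0"
  note [measurable] = iid_seq_measurable[OF iid]
  define \<mu> where "\<mu> = expectation (\<lambda>\<omega>. f (Z 0 \<omega>))"
  define v where "v = expectation (\<lambda>\<omega>. (f (Z 0 \<omega>) - \<mu>)\<^sup>2)"
  define X where "X i \<omega> = f (Z i \<omega>) - \<mu>" for i \<omega>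
  have [measurable]: "X i \<in> borel_measurable M" for i
    unfolding X_def by measurable
  have int_f: "integrable M (\<lambda>\<omega>. f (Z 0 \<omega>))"
    by (rule square_integrable_imp_integrable) (use sq in auto)
  have int: "integrable M (X i)" for i
    unfolding X_def using iid_seq_integral_eq(2)[OF iid f, of i] int_f by simp
  have mean: "expectation (X i) = 0" for i
    unfolding X_def using iid_seq_integral_eq[OF iid f, of i] int_f
    by (simp add: \<mu>_def prob_space)
  have int2_0: "integrable M (\<lambda>\<omega>. (f (Z 0 \<omega>) - \<mu>)\<^sup>2)"
    unfolding power2_diff using sq int_f by simp
  have meas2: "(\<lambda>z. (f z - \<mu>)\<^sup>2) \<in> borel_measurable borel" by measurable
  have int2: "integrable M (\<lambda>\<omega>. X i \<omega> * X i \<omega>)" "expectation (\<lambda>\<omega>. X i \<omega> * X i \<omega>) = v" for i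
    using iid_seq_integral_eq[OF iid meas2, of i] int2_0
    by (simp_all add: X_def v_def power2_eq_square)
  \<comment> \<open>The cross terms in the variance of the sum vanish; pairwise independence
    suffices for this.\<close>
  have indep: "integrable M (\<lambda>\<omega>. X i \<omega> * X j \<omega>)" "expectation (\<lambda>\<omega>. X i \<omega> * X j \<omega>) = 0"
    if "i \<noteq> j" for i j
  proof -
    have "indep_vars (\<lambda>_. borel) Z {i, j}"
      using iid_seq_indep[OF iid] by (rule indep_vars_subset) simp
    then have X: "indep_vars (\<lambda>_. borel) X {i, j}"
      unfolding X_def[abs_def] by (rule indep_vars_compose2) measurable
    show "integrable M (\<lambda>\<omega>. X i \<omega> * X j \<omega>)" "expectation (\<lambda>\<omega>. X i \<omega> * X j \<omega>) = 0"
      using indep_vars_integrable[OF _ X] indep_vars_lebesgue_integral[OF _ X] that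
      by (simp_all add: int mean)
  qed
  have intX: "integrable M (\<lambda>\<omega>. X i \<omega> * X j \<omega>)" for i j
    using indep int2 by (cases "i = j") auto
  have eX: "expectation (\<lambda>\<omega>. X i \<omega> * X j \<omega>) = (if i = j then v else 0)" for i j
    using indep int2 by (cases "i = j") auto
  define S where "S N \<omega> = (\<Sum>i<N. X i \<omega>)" for N \<omega>
  have [measurable]: "S N \<in> borel_measurable M" for N
    unfolding S_def by measurable
  have S2: "(S N \<omega>)\<^sup>2 = (\<Sum>i<N. \<Sum>j<N. X i \<omega> * X j \<omega>)" for N \<omega>
    unfolding S_def power2_eq_square by (rule sum_product)
  have intS: "integrable M (\<lambda>\<omega>. (S N \<omega>)\<^sup>2)" for N
    unfolding S2 by (intro Bochner_Integration.integrable_sum intX)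
  have eS: "expectation (\<lambda>\<omega>. (S N \<omega>)\<^sup>2) = real N * v" for N
    unfolding S2 by (simp add: Bochner_Integration.integral_sum intX eX)
  have meanS: "expectation (S N) = 0" for N
    unfolding S_def by (simp add: Bochner_Integration.integral_sum int mean)
  \<comment> \<open>With \<open>Suc N\<close> the threshold is positive even at
    \<open>N = 0\<close>, as Chebyshev requires. The factor one half absorbs the shift:
    \<open>Suc N / 2\<close> is at most \<open>N\<close> once \<open>N > 0\<close>.\<close>
  define G where "G N = {\<omega> \<in> space M. \<bar>S N \<omega>\<bar> \<ge> real (Suc N) * \<epsilon> / 2}" for N
  have G_sets: "G N \<in> sets M" for N
    unfolding G_def by measurable
  have v0: "v \<ge> 0" unfolding v_def by simp
  have G_le: "prob (G N) \<le> (4 * v / \<epsilon>\<^sup>2) * (1 / real (Suc N))" for N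
  proof -
    have "prob (G N) \<le> real N * v / (real (Suc N) * \<epsilon> / 2)\<^sup>2"
      using Chebyshev_inequality[of "S N" "real (Suc N) * \<epsilon> / 2"] intS \<epsilon> eS
      by (simp add: meanS G_def)
    also have "\<dots> \<le> real (Suc N) * v / (real (Suc N) * \<epsilon> / 2)\<^sup>2"
      using v0 by (intro divide_right_mono mult_right_mono) auto
    also have "\<dots> = (4 * v / \<epsilon>\<^sup>2) * (1 / real (Suc N))"
      using \<epsilon> by (simp add: power2_eq_square field_simps del: of_nat_Suc)
    finally show ?thesis .
  qed
  have G0: "(\<lambda>N. prob (G N)) \<longlonglongrightarrow> 0"
  proof (rule tendsto_sandwich[of "\<lambda>_. 0"])
    show "(\<lambda>N. (4 * v / \<epsilon>\<^sup>2) * (1 / real (Suc N))) \<longlonglongrightarrow> 0"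
      by (intro tendsto_mult_right_zero LIMSEQ_Suc lim_1_over_n)
    show "\<forall>\<^sub>F N in sequentially. prob (G N) \<le> (4 * v / \<epsilon>\<^sup>2) * (1 / real (Suc N))"
      by (intro always_eventually allI G_le)
  qed auto
  have ev: "dist (sample_mean Z f (N, \<omega>)) \<mu> < \<epsilon>" if "\<omega> \<in> space M - G N" "N > 0" for N \<omega>
  proof -
    have "sample_mean Z f (N, \<omega>) - \<mu> = S N \<omega> / real N"
      using that by (simp add: sample_mean_def S_def X_def sum_subtractf field_simps)
    moreover have "\<bar>S N \<omega>\<bar> < real N * \<epsilon>"
    proof -
      have "\<bar>S N \<omega>\<bar> < real (Suc N) * \<epsilon> / 2" using that by (auto simp: G_def)
      also have "\<dots> \<le> real N * \<epsilon>" using that \<epsilon> by (simp add: field_simps)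
      finally show ?thesis .
    qed
    ultimately show ?thesis
      using that by (simp add: dist_real_def pos_divide_less_eq mult.commute)
  qed
  have "\<forall>\<^sub>F N in sequentially. \<forall>\<omega>\<in>space M - G N. dist (sample_mean Z f (N, \<omega>)) \<mu> < \<epsilon>"
    using eventually_gt_at_top[of 0] by eventually_elim (use ev in auto)
  then show "\<forall>\<^sub>F p in whp M. dist (sample_mean Z f p) (expectation (\<lambda>\<omega>. f (Z 0 \<omega>))) < \<epsilon>"
    unfolding eventually_whp using G_sets G0 by (auto simp: \<mu>_def)
qed

text \<open>Reduces to the real case coordinate by coordinate, each coordinate being dominated by
  the norm.\<close>

lemma (in prob_space) sample_mean_tendsto:
  fixes f :: "'b::topological_space \<Rightarrow> 'c::euclidean_space"
  assumes iid: "iid_seq M Z" and f[measurable]: "f \<in> borel_measurable borel"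
    and sq: "integrable M (\<lambda>\<omega>. (norm (f (Z 0 \<omega>)))\<^sup>2)"
  shows "(sample_mean Z f \<longlongrightarrow> expectation (\<lambda>\<omega>. f (Z 0 \<omega>))) (whp M)"
proof -
  note [measurable] = iid_seq_measurable[OF iid]
  have "integrable M (\<lambda>\<omega>. norm (f (Z 0 \<omega>)))"
    by (rule square_integrable_imp_integrable) (use sq in auto)
  then have int: "integrable M (\<lambda>\<omega>. f (Z 0 \<omega>))"
    by (subst (asm) integrable_norm_iff) auto
  have "((\<lambda>p. sample_mean Z f p \<bullet> b) \<longlongrightarrow> expectation (\<lambda>\<omega>. f (Z 0 \<omega>)) \<bullet> b) (whp M)"
    if b: "b \<in> Basis" for b
  proof -
    have "integrable M (\<lambda>\<omega>. (f (Z 0 \<omega>) \<bullet> b)\<^sup>2)"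
    proof (rule Bochner_Integration.integrable_bound[OF sq])
      show "AE \<omega> in M. norm ((f (Z 0 \<omega>) \<bullet> b)\<^sup>2) \<le> norm ((norm (f (Z 0 \<omega>)))\<^sup>2)"
        using Basis_le_norm[OF b] by (auto simp: abs_le_square_iff[symmetric])
    qed measurable
    then have "(sample_mean Z (\<lambda>z. f z \<bullet> b) \<longlongrightarrow> expectation (\<lambda>\<omega>. f (Z 0 \<omega>) \<bullet> b)) (whp M)"
      by (intro sample_mean_tendsto_real iid) auto
    moreover have "sample_mean Z (\<lambda>z. f z \<bullet> b) = (\<lambda>p. sample_mean Z f p \<bullet> b)"
      by (simp add: fun_eq_iff sample_mean_def inner_sum_left)
    ultimately show ?thesis using int by simp
  qed
  then show ?thesis by (subst tendsto_componentwise_iff) auto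
qed

text \<open>The error splits into the deviation at the fixed parameter and an oscillation term. Once
  \<open>T\<close> is within \<open>r n\<close>, the latter is at most the sample mean of the
  envelope \<open>D n\<close>, which obeys the law of large numbers.\<close>

lemma (in prob_space) sample_mean_plug_in_tendsto:
  fixes F :: "'b::topological_space \<Rightarrow> 'p::metric_space \<Rightarrow> 'c::euclidean_space"
    and D :: "nat \<Rightarrow> 'b \<Rightarrow> real"
  assumes iid: "iid_seq M Z"
    and F_meas: "(\<lambda>z. F z \<theta>) \<in> borel_measurable borel"
    and F_sq: "integrable M (\<lambda>\<omega>. (norm (F (Z 0 \<omega>) \<theta>))\<^sup>2)"
    and D_meas: "\<And>n. D n \<in> borel_measurable borel"
    and D_sq: "\<And>n. integrable M (\<lambda>\<omega>. (D n (Z 0 \<omega>))\<^sup>2)"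
    and D_lim: "(\<lambda>n. expectation (\<lambda>\<omega>. D n (Z 0 \<omega>))) \<longlonglongrightarrow> 0"
    and r: "\<And>n. r n > 0"
    and bound: "\<And>n i \<omega> t. \<omega> \<in> space M \<Longrightarrow> dist t \<theta> < r n \<Longrightarrow>
      norm (F (Z i \<omega>) t - F (Z i \<omega>) \<theta>) \<le> D n (Z i \<omega>)"
    and T: "(T \<longlongrightarrow> \<theta>) (whp M)"
  shows "((\<lambda>p. sample_mean Z (\<lambda>z. F z (T p)) p) \<longlongrightarrow> expectation (\<lambda>\<omega>. F (Z 0 \<omega>) \<theta>)) (whp M)"
proof (rule tendstoI)
  fix \<epsilon> :: real assume \<epsilon>: "\<epsilon> > 0"
  \<comment> \<open>The radius is fixed from \<epsilon> before the sample grows, so the law of large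
    numbers is applied to a single function \<open>D n\<close>.\<close>
  obtain n where n: "expectation (\<lambda>\<omega>. D n (Z 0 \<omega>)) < \<epsilon> / 2"
    using order_tendstoD(2)[OF D_lim, of "\<epsilon> / 2"] \<epsilon> by (auto simp: eventually_sequentially)
  have "(sample_mean Z (D n) \<longlongrightarrow> expectation (\<lambda>\<omega>. D n (Z 0 \<omega>))) (whp M)"
    by (intro sample_mean_tendsto_real iid D_meas D_sq)
  then have "\<forall>\<^sub>F p in whp M. sample_mean Z (D n) p < \<epsilon> / 2"
    using n by (rule order_tendstoD)
  moreover have "\<forall>\<^sub>F p in whp M.
      dist (sample_mean Z (\<lambda>z. F z \<theta>) p) (expectation (\<lambda>\<omega>. F (Z 0 \<omega>) \<theta>)) < \<epsilon> / 2"
    using \<epsilon> by (intro tendstoD sample_mean_tendsto iid F_meas F_sq) auto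
  moreover have "\<forall>\<^sub>F p in whp M. dist (T p) \<theta> < r n"
    using T r by (rule tendstoD)
  ultimately show "\<forall>\<^sub>F p in whp M.
      dist (sample_mean Z (\<lambda>z. F z (T p)) p) (expectation (\<lambda>\<omega>. F (Z 0 \<omega>) \<theta>)) < \<epsilon>"
    using eventually_whp_space
  proof eventually_elim
    case (elim p)
    have "norm (sample_mean Z (\<lambda>z. F z (T p) - F z \<theta>) p) \<le> sample_mean Z (D n) p"
      using elim by (intro norm_sample_mean_le bound) auto
    then have "dist (sample_mean Z (\<lambda>z. F z (T p)) p) (sample_mean Z (\<lambda>z. F z \<theta>) p) < \<epsilon> / 2"
      using elim by (simp add: sample_mean_diff dist_norm)
    with elim(2) show ?case
      using dist_triangle_half_l by (metis dist_commute)
  qed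
qed

text \<open>Wald's argument: away from \<theta> the population objective exceeds its minimum by a
  fixed gap. A finite net and the averaged Lipschitz bound carry enough of this gap over to the
  sample objective to exclude a minimizer there.\<close>

lemma (in prob_space) M_estimator_consistent:
  fixes q :: "'b::topological_space \<Rightarrow> 'p::metric_space \<Rightarrow> real" and L :: "'b \<Rightarrow> real"
  assumes iid: "iid_seq M Z"
    and q_meas: "\<And>t. t \<in> B \<Longrightarrow> (\<lambda>z. q z t) \<in> borel_measurable borel"
    and q_sq: "\<And>t. t \<in> B \<Longrightarrow> integrable M (\<lambda>\<omega>. (q (Z 0 \<omega>) t)\<^sup>2)"
    and L_meas: "L \<in> borel_measurable borel"
    and L_sq: "integrable M (\<lambda>\<omega>. (L (Z 0 \<omega>))\<^sup>2)"
    and lipschitz: "\<And>i \<omega> s t. \<omega> \<in> space M \<Longrightarrow> s \<in> B \<Longrightarrow> t \<in> B \<Longrightarrow>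
      \<bar>q (Z i \<omega>) s - q (Z i \<omega>) t\<bar> \<le> L (Z i \<omega>) * dist s t"
    and compact: "compact B" and \<theta>: "\<theta> \<in> B"
    and unique: "\<And>t. t \<in> B \<Longrightarrow> t \<noteq> \<theta> \<Longrightarrow>
      expectation (\<lambda>\<omega>. q (Z 0 \<omega>) \<theta>) < expectation (\<lambda>\<omega>. q (Z 0 \<omega>) t)"
    and T_in: "\<forall>\<^sub>F p in whp M. T p \<in> B"
    and T_min: "\<forall>\<^sub>F p in whp M. sample_mean Z (\<lambda>z. q z (T p)) p \<le> sample_mean Z (\<lambda>z. q z \<theta>) p"
  shows "(T \<longlongrightarrow> \<theta>) (whp M)"
proof (rule tendstoI)
  fix \<epsilon> :: real assume \<epsilon>: "\<epsilon> > 0"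
  note [measurable] = iid_seq_measurable[OF iid] L_meas
  define Q where "Q t = expectation (\<lambda>\<omega>. q (Z 0 \<omega>) t)" for t
  define l where "l = expectation (\<lambda>\<omega>. L (Z 0 \<omega>))"
  have L_int: "integrable M (\<lambda>\<omega>. L (Z 0 \<omega>))"
    by (rule square_integrable_imp_integrable) (use L_sq in auto)
  have q_int: "integrable M (\<lambda>\<omega>. q (Z 0 \<omega>) t)" if "t \<in> B" for t
  proof (rule square_integrable_imp_integrable)
    show "(\<lambda>\<omega>. q (Z 0 \<omega>) t) \<in> borel_measurable M"
      using q_meas[OF that, measurable] by measurable
  qed (rule q_sq[OF that])
  have Q_lip: "\<bar>Q s - Q t\<bar> \<le> l * dist s t" if "s \<in> B" "t \<in> B" for s t
  proof -
    have "\<bar>Q s - Q t\<bar> = \<bar>expectation (\<lambda>\<omega>. q (Z 0 \<omega>) s - q (Z 0 \<omega>) t)\<bar>"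
      using that q_int by (simp add: Q_def)
    also have "\<dots> \<le> expectation (\<lambda>\<omega>. \<bar>q (Z 0 \<omega>) s - q (Z 0 \<omega>) t\<bar>)"
      by (rule integral_abs_bound)
    also have "\<dots> \<le> expectation (\<lambda>\<omega>. L (Z 0 \<omega>) * dist s t)"
      using that q_int L_int lipschitz by (intro integral_mono) auto
    finally show ?thesis by (simp add: l_def)
  qed
  have Q_cont: "continuous_on B Q"
  proof (rule continuous_onI)
    fix t and e :: real assume t: "t \<in> B" and e: "e > 0"
    \<comment> \<open>The constant \<open>\<bar>l\<bar> + 1\<close> bounds \<open>l\<close> from
      above and is safely positive as a divisor.\<close>
    have "dist (Q s) (Q t) \<le> e" if s: "s \<in> B" and "dist s t < e / (\<bar>l\<bar> + 1)" for s
    proof -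
      have "\<bar>Q s - Q t\<bar> \<le> (\<bar>l\<bar> + 1) * dist s t"
        by (rule order.trans[OF Q_lip[OF s t]]) (intro mult_right_mono, auto)
      also have "\<dots> \<le> e" using that by (simp add: field_simps)
      finally show ?thesis by (simp add: dist_real_def)
    qed
    then show "\<exists>d>0. \<forall>s\<in>B. dist s t < d \<longrightarrow> dist (Q s) (Q t) \<le> e"
      using e by (intro exI[of _ "e / (\<bar>l\<bar> + 1)"]) auto
  qed
  define K where "K = B - ball \<theta> \<epsilon>"
  have K: "compact K" unfolding K_def using compact by (intro compact_diff) auto
  have KB: "K \<subseteq> B" by (auto simp: K_def)
  \<comment> \<open>The gap: a continuous function attains its minimum on the compact set
    \<open>K\<close>, and uniqueness makes that minimum larger than \<open>Q \<theta>\<close>. If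
    \<open>K\<close> is empty, any positive number will do.\<close>
  obtain \<eta> where \<eta>: "\<eta> > 0" "\<And>t. t \<in> K \<Longrightarrow> Q \<theta> + \<eta> \<le> Q t"
  proof (cases "K = {}")
    case False
    obtain s where s: "s \<in> K" "\<And>t. t \<in> K \<Longrightarrow> Q s \<le> Q t"
      using continuous_attains_inf[OF K False continuous_on_subset[OF Q_cont KB]] by blast
    have "Q \<theta> < Q s"
      using s(1) \<epsilon> unique[of s] by (cases "s = \<theta>") (auto simp: K_def Q_def)
    then show ?thesis using s that[of "Q s - Q \<theta>"] by auto
  qed (use that[of 1] in auto)
  \<comment> \<open>Chosen so that moving from a point to its net centre changes the sample
    objective by at most \<open>\<eta> / 4\<close> when the averaged Lipschitz constant is below
    \<open>\<bar>l\<bar> + 1\<close>.\<close>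
  define \<rho> where "\<rho> = \<eta> / (4 * (\<bar>l\<bar> + 1))"
  have \<rho>: "\<rho> > 0" using \<eta> by (simp add: \<rho>_def)
  obtain C where C: "finite C" "C \<subseteq> K" "K \<subseteq> (\<Union>c\<in>C. ball c \<rho>)"
  proof (rule compactE_image[OF K, of K "\<lambda>c. ball c \<rho>"])
    show "K \<subseteq> (\<Union>c\<in>K. ball c \<rho>)" using \<rho> by force
  qed auto
  have near: "\<forall>\<^sub>F p in whp M. dist (sample_mean Z (\<lambda>z. q z t) p) (Q t) < \<eta> / 4" if "t \<in> B" for t
    unfolding Q_def using \<eta> that
    by (intro tendstoD sample_mean_tendsto_real iid q_meas q_sq) auto
  have "\<forall>\<^sub>F p in whp M. \<forall>c\<in>C. dist (sample_mean Z (\<lambda>z. q z c) p) (Q c) < \<eta> / 4"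
    using C KB near by (intro eventually_ball_finite) auto
  moreover have "\<forall>\<^sub>F p in whp M. dist (sample_mean Z (\<lambda>z. q z \<theta>) p) (Q \<theta>) < \<eta> / 4"
    using \<theta> by (rule near)
  moreover have "\<forall>\<^sub>F p in whp M. sample_mean Z L p < \<bar>l\<bar> + 1"
    using sample_mean_tendsto_real[OF iid L_meas L_sq] by (rule order_tendstoD) (simp add: l_def)
  ultimately show "\<forall>\<^sub>F p in whp M. dist (T p) \<theta> < \<epsilon>"
    using eventually_whp_space T_in T_min
  proof eventually_elim
    case (elim p)
    show ?case
    proof (rule ccontr)
      assume "\<not> dist (T p) \<theta> < \<epsilon>"
      then have TK: "T p \<in> K" using elim by (auto simp: K_def dist_commute)
      then obtain c where c: "c \<in> C" "dist c (T p) < \<rho>" using C(3) by auto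
      have cB: "c \<in> B" using c C KB by auto
      have "norm (sample_mean Z (\<lambda>z. q z c - q z (T p)) p)
          \<le> sample_mean Z (\<lambda>z. L z * dist c (T p)) p"
        using elim lipschitz[OF _ cB] by (intro norm_sample_mean_le) auto
      also have "\<dots> = sample_mean Z L p * dist c (T p)"
        by (simp add: sample_mean_def sum_distrib_right)
      also have "\<dots> \<le> (\<bar>l\<bar> + 1) * \<rho>"
        using elim(3) c(2) by (intro mult_mono) auto
      also have "\<dots> = \<eta> / 4"
      proof -
        have cancel: "m * (\<eta> / (4 * m)) = \<eta> / 4" if "m > 0" for m :: real
          using that by simp
        show ?thesis unfolding \<rho>_def by (rule cancel) linarith
      qed
      finally have "\<bar>sample_mean Z (\<lambda>z. q z c) p - sample_mean Z (\<lambda>z. q z (T p)) p\<bar> \<le> \<eta> / 4"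
        by (simp add: sample_mean_diff)
      moreover have "\<bar>sample_mean Z (\<lambda>z. q z c) p - Q c\<bar> < \<eta> / 4"
        using elim(1) c by (auto simp: dist_real_def)
      moreover have "\<bar>sample_mean Z (\<lambda>z. q z \<theta>) p - Q \<theta>\<bar> < \<eta> / 4"
        using elim(2) by (simp add: dist_real_def)
      \<comment> \<open>Three errors of at most a quarter gap each (net, sampling at
        \<open>c\<close>, sampling at \<theta>) cannot bridge the full gap \<eta>, contradicting
        minimality of \<open>T p\<close>.\<close>
      moreover have "Q \<theta> + \<eta> \<le> Q c" using c C by (intro \<eta>) auto
      ultimately show False using elim(6) \<eta>(1) by linarith
    qed
  qed
qed

subsection \<open>Continuity of the sandwich\<close>

text \<open>The determinant is a polynomial in the entries. The entrywise hypothesis also fits the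
  matrices of Cramer's rule, which have one column replaced.\<close>

lemma tendsto_det:
  fixes A :: "'a \<Rightarrow> real ^ 'n ^ 'n"
  assumes "\<And>i j. ((\<lambda>x. A x $ i $ j) \<longlongrightarrow> L $ i $ j) F"
  shows "((\<lambda>x. det (A x)) \<longlongrightarrow> det L) F"
  unfolding det_def by (intro tendsto_intros assms)

lemma matrix_mult_matrix_inv:
  assumes "invertible A"
  shows "A ** matrix_inv A = mat 1"
  using someI_ex[OF assms[unfolded invertible_def]] by (simp add: matrix_inv_def)

text \<open>Column \<open>j\<close> of the inverse solves a linear system with the
  \<open>j\<close>-th unit vector on the right. Cramer's rule then gives quotients of determinants,
  whose continuity is evident.\<close>

lemma matrix_inv_cramer:
  fixes A :: "real ^ 'n ^ 'n"
  assumes "invertible A"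
  shows "matrix_inv A $ i $ j = det (\<chi> r s. if s = i then axis j 1 $ r else A $ r $ s) / det A"
proof -
  have "A *v (matrix_inv A *v axis j 1) = axis j 1"
    using assms by (simp add: matrix_vector_mul_assoc matrix_mult_matrix_inv)
  then have "matrix_inv A *v axis j 1 =
      (\<chi> k. det (\<chi> r s. if s = k then axis j 1 $ r else A $ r $ s) / det A)"
    using assms by (subst (asm) cramer) (auto simp: invertible_det_nz)
  moreover have "matrix_inv A $ i $ j = (matrix_inv A *v axis j 1) $ i"
    by (simp add: matrix_vector_mul_component inner_axis)
  ultimately show ?thesis by simp
qed

text \<open>A nonzero limit of determinants forces invertibility eventually; from then on the
  inverse agrees with its Cramer quotients, which converge.\<close>

lemma
  fixes A :: "'a \<Rightarrow> real ^ 'n ^ 'n"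
  assumes A: "(A \<longlongrightarrow> L) F" and L: "invertible L"
  shows eventually_invertible: "\<forall>\<^sub>F x in F. invertible (A x)"
    and tendsto_matrix_inv: "((\<lambda>x. matrix_inv (A x)) \<longlongrightarrow> matrix_inv L) F"
proof -
  have entry: "((\<lambda>x. A x $ i $ j) \<longlongrightarrow> L $ i $ j) F" for i j
    using A by (intro tendsto_vec_nth)
  have det_lim: "((\<lambda>x. det (A x)) \<longlongrightarrow> det L) F"
    by (intro tendsto_det entry)
  have L0: "det L \<noteq> 0" using L by (simp add: invertible_det_nz)
  show inv: "\<forall>\<^sub>F x in F. invertible (A x)"
    using tendsto_imp_eventually_ne[OF det_lim L0] by (simp add: invertible_det_nz)
  show "((\<lambda>x. matrix_inv (A x)) \<longlongrightarrow> matrix_inv L) F"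
  proof (intro vec_tendstoI)
    fix i j
    have "((\<lambda>x. det (\<chi> r s. if s = i then axis j 1 $ r else A x $ r $ s) / det (A x)) \<longlongrightarrow>
        det (\<chi> r s. if s = i then axis j 1 $ r else L $ r $ s) / det L) F"
      using L0 by (intro tendsto_divide tendsto_det det_lim) (auto intro: entry)
    then show "((\<lambda>x. matrix_inv (A x) $ i $ j) \<longlongrightarrow> matrix_inv L $ i $ j) F"
      unfolding matrix_inv_cramer[OF L]
      by (rule Lim_transform_eventually)
        (use inv in eventually_elim, simp add: matrix_inv_cramer)
  qed
qed

lemma tendsto_matrix_matrix_mult:
  fixes A :: "'a \<Rightarrow> real ^ 'n ^ 'm" and B :: "'a \<Rightarrow> real ^ 'k ^ 'n"
  assumes "(A \<longlongrightarrow> A') F" and "(B \<longlongrightarrow> B') F"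
  shows "((\<lambda>x. A x ** B x) \<longlongrightarrow> A' ** B') F"
  unfolding matrix_matrix_mult_def
  by (intro vec_tendstoI) (auto intro!: tendsto_intros assms)

lemma tendsto_sandwich_matrix:
  fixes A :: "'a \<Rightarrow> real ^ 'n ^ 'n"
  assumes "(A \<longlongrightarrow> A') F" and "(W \<longlongrightarrow> W') F" and "invertible A'"
  shows "((\<lambda>x. sandwich (A x) (W x)) \<longlongrightarrow> sandwich A' W') F"
  unfolding sandwich_def by (intro tendsto_matrix_matrix_mult tendsto_matrix_inv assms)

text \<open>A nonzero kernel vector would annihilate the quadratic form.\<close>

lemma pos_definite_invertible:
  assumes "pos_definite A"
  shows "invertible A"
proof -
  have "v = 0" if "A *v v = 0" for v
    using assms that by (force simp: pos_definite_def)
  then have "\<exists>B. B ** A = mat 1"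
    by (simp add: matrix_left_invertible_ker)
  then show ?thesis
    by (simp add: invertible_left_inverse)
qed

subsection \<open>The ramp model\<close>

lemma ramp_bounds: "0 \<le> ramp z" "ramp z \<le> 1"
  by (auto simp: ramp_def)

lemma ramp_lipschitz: "\<bar>ramp s - ramp t\<bar> \<le> \<bar>s - t\<bar>"
  by (auto simp: ramp_def)

lemma ramp_eq: "ramp = (\<lambda>z. max 0 (min 1 z))"
  by (auto simp: ramp_def fun_eq_iff)

lemma borel_measurable_ramp[measurable]: "ramp \<in> borel_measurable borel"
  unfolding ramp_eq by measurable

lemma square_residual_bounds:
  assumes "y \<in> {0, 1::real}"
  shows "0 \<le> (y - ramp z)\<^sup>2" "(y - ramp z)\<^sup>2 \<le> 1"
  using assms ramp_bounds[of z] by (auto simp: abs_square_le_1)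

text \<open>Factor the difference of squares: the sum of two residuals is at most 2 in absolute
  value, and their difference inherits the Lipschitz constant 1 of the ramp.\<close>

lemma square_residual_lipschitz:
  assumes "y \<in> {0, 1::real}"
  shows "\<bar>(y - ramp s)\<^sup>2 - (y - ramp t)\<^sup>2\<bar> \<le> 2 * \<bar>s - t\<bar>"
proof -
  have "(y - ramp s)\<^sup>2 - (y - ramp t)\<^sup>2 = (2 * y - ramp s - ramp t) * (ramp t - ramp s)"
    by (simp add: power2_eq_square algebra_simps)
  moreover have "\<bar>2 * y - ramp s - ramp t\<bar> \<le> 2"
    using assms ramp_bounds[of s] ramp_bounds[of t] by auto
  ultimately show ?thesis
    using ramp_lipschitz[of t s] by (simp add: abs_mult mult_mono abs_minus_commute)
qed

text \<open>The norm on matrices is the Frobenius norm, and row \<open>a\<close> of the rank-one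
  matrix is \<open>x $ a\<close> times \<open>x\<close>.\<close>

lemma norm_gram: "norm (gram x) = (norm x)\<^sup>2"
proof -
  have row: "gram x $ a = (x $ a) *\<^sub>R x" for a
    by (simp add: gram_def vec_eq_iff)
  have "norm (gram x) = L2_set (\<lambda>a. norm (x $ a) * norm x) UNIV"
    by (subst norm_vec_def) (simp add: row)
  also have "\<dots> = norm x * norm x"
    by (subst L2_set_left_distrib[symmetric]) (simp_all add: norm_vec_def)
  finally show ?thesis by (simp add: power2_eq_square)
qed

lemma borel_measurable_gram[measurable]: "gram \<in> borel_measurable borel"
  unfolding gram_def by (intro borel_measurable_continuous_onI continuous_intros)

text \<open>
  The indicator can change within distance \<open>d\<close> of \<open>\<beta>\<close> only if the index at \<open>\<beta>\<close> is within
  \<open>norm x * d\<close> of a kink. Truncation by \<open>1\<close> keeps the square integrable under fourth moments, which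
  the cubic term \<open>2 * norm x ^ 3 * d\<close> would not be.
\<close>

definition modulus :: "real ^ 'k \<Rightarrow> real \<Rightarrow> real \<times> (real ^ 'k) \<Rightarrow> real" where
  "modulus \<beta> d z = (let x = snd z in (norm x)\<^sup>2 *
     (min 1 (2 * (norm x * d)) + of_bool (\<bar>x \<bullet> \<beta>\<bar> \<le> norm x * d \<or> \<bar>x \<bullet> \<beta> - 1\<bar> \<le> norm x * d)))"

text \<open>The upper bound is free of \<open>d\<close>: it serves as the dominating function when
  \<open>d\<close> tends to 0, and its square has finite mean under fourth moments.\<close>

lemma modulus_bounds:
  assumes "d \<ge> 0"
  shows "0 \<le> modulus \<beta> d z" "modulus \<beta> d z \<le> 2 * (norm (snd z))\<^sup>2"
proof -
  have "(norm x)\<^sup>2 * (min 1 (2 * (norm x * d)) + of_bool P) \<le> (norm x)\<^sup>2 * 2" for x :: "real ^ 'k" and P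
    by (intro mult_left_mono) auto
  then show "modulus \<beta> d z \<le> 2 * (norm (snd z))\<^sup>2"
    unfolding modulus_def Let_def by (metis mult.commute)
  show "0 \<le> modulus \<beta> d z" using assms by (simp add: modulus_def Let_def)
qed

lemma borel_measurable_modulus[measurable]: "modulus \<beta> d \<in> borel_measurable borel"
  unfolding modulus_def Let_def borel_prod[symmetric] by measurable

text \<open>The weights \<open>a\<close> and \<open>b\<close> are 1 for the matrix \<open>A\<close>
  and squared residuals for \<Omega>, so one estimate covers both. If the indicators agree, only the
  weights differ; if not, the index is near a kink.\<close>

lemma norm_scaled_gram_diff_le_modulus:
  assumes "\<bar>a - b\<bar> \<le> 2 * \<bar>x \<bullet> t - x \<bullet> \<beta>\<bar>" and "a \<in> {0..1}" and "b \<in> {0..1}" and "dist t \<beta> < d"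
  shows "norm ((a * indicat_real {0<..<1} (x \<bullet> t)) *\<^sub>R gram x -
      (b * indicat_real {0<..<1} (x \<bullet> \<beta>)) *\<^sub>R gram x) \<le> modulus \<beta> d (y, x)"
proof -
  have "\<bar>x \<bullet> t - x \<bullet> \<beta>\<bar> = \<bar>x \<bullet> (t - \<beta>)\<bar>" by (simp add: inner_diff_right)
  also have "\<dots> \<le> norm x * norm (t - \<beta>)" by (rule Cauchy_Schwarz_ineq2)
  also have "\<dots> \<le> norm x * d" using assms(4) by (intro mult_left_mono) (auto simp: dist_norm)
  finally have close: "\<bar>x \<bullet> t - x \<bullet> \<beta>\<bar> \<le> norm x * d" .
  have "\<bar>a * indicat_real {0<..<1} (x \<bullet> t) - b * indicat_real {0<..<1} (x \<bullet> \<beta>)\<bar> \<le>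
      min 1 (2 * (norm x * d)) + of_bool (\<bar>x \<bullet> \<beta>\<bar> \<le> norm x * d \<or> \<bar>x \<bullet> \<beta> - 1\<bar> \<le> norm x * d)"
  proof (cases "x \<bullet> t \<in> {0<..<1} \<longleftrightarrow> x \<bullet> \<beta> \<in> {0<..<1}")
    case True
    then show ?thesis using assms close by (auto simp: indicator_def)
  next
    case False
    \<comment> \<open>One of the kinks 0 and 1 separates the two indices, so it is no farther from
      \<open>x \<bullet> \<beta>\<close> than \<open>x \<bullet> t\<close> is.\<close>
    then have "\<bar>x \<bullet> \<beta>\<bar> \<le> norm x * d \<or> \<bar>x \<bullet> \<beta> - 1\<bar> \<le> norm x * d" using close by auto
    with False show ?thesis using assms close by (auto simp: indicator_def)
  qed
  then show ?thesis
    by (simp add: modulus_def norm_gram mult.commute mult_left_mono flip: scaleR_diff_left)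
qed

text \<open>The window around each kink eventually shrinks below the positive distance of the index
  from it. The indicator part then vanishes, and the Lipschitz part tends to 0 with the
  radius.\<close>

lemma modulus_tendsto_0:
  assumes "snd z \<bullet> \<beta> \<noteq> 0" and "snd z \<bullet> \<beta> \<noteq> 1"
  shows "(\<lambda>n. modulus \<beta> (inverse (real (Suc n))) z) \<longlonglongrightarrow> 0"
proof -
  define x where "x = snd z"
  have d: "(\<lambda>n. norm x * inverse (real (Suc n))) \<longlonglongrightarrow> 0"
    by (intro tendsto_mult_right_zero LIMSEQ_inverse_real_of_nat)
  have "(\<lambda>n. (norm x)\<^sup>2 * min 1 (2 * (norm x * inverse (real (Suc n))))) \<longlonglongrightarrow> (norm x)\<^sup>2 * min 1 (2 * 0)"
    by (intro tendsto_intros d)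
  then have "(\<lambda>n. (norm x)\<^sup>2 * min 1 (2 * (norm x * inverse (real (Suc n))))) \<longlonglongrightarrow> 0"
    by simp
  moreover have "\<forall>\<^sub>F n in sequentially. (norm x)\<^sup>2 * min 1 (2 * (norm x * inverse (real (Suc n)))) =
      modulus \<beta> (inverse (real (Suc n))) z"
  proof -
    have "\<forall>\<^sub>F n in sequentially. norm x * inverse (real (Suc n)) < \<bar>x \<bullet> \<beta>\<bar>"
      using assms by (intro order_tendstoD(2)[OF d]) (simp add: x_def)
    moreover have "\<forall>\<^sub>F n in sequentially. norm x * inverse (real (Suc n)) < \<bar>x \<bullet> \<beta> - 1\<bar>"
      using assms by (intro order_tendstoD(2)[OF d]) (simp add: x_def)
    ultimately show ?thesis
      by eventually_elim (simp add: modulus_def x_def Let_def)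
  qed
  ultimately show ?thesis by (rule Lim_transform_eventually)
qed

text \<open>The jump of the distribution function at \<open>c\<close> is the mass of the point
  \<open>c\<close>.\<close>

lemma (in prob_space) continuously_distributed_AE_neq:
  assumes [measurable]: "X \<in> borel_measurable M" and cont: "continuously_distributed M X"
  shows "AE \<omega> in M. X \<omega> \<noteq> c"
proof -
  interpret D: real_distribution "distr M borel X" by (rule real_distribution_distr) simp
  have "isCont (cdf (distr M borel X)) c"
    using cont by (simp add: continuously_distributed_def continuous_on_eq_continuous_at)
  then have "prob (X -` {c} \<inter> space M) = 0"
    by (simp add: D.isCont_cdf measure_distr)
  then have "AE \<omega> in M. \<omega> \<notin> X -` {c} \<inter> space M"
    by (intro AE_not_in) (simp add: null_sets_def emeasure_eq_measure)
  then show ?thesis by (auto elim: AE_mp)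
qed

lemma borel_measurable_fst: "fst \<in> borel_measurable (borel :: ('a::topological_space \<times> 'b::topological_space) measure)"
  by (intro borel_measurable_continuous_onI continuous_intros)

lemma borel_measurable_snd: "snd \<in> borel_measurable (borel :: ('a::topological_space \<times> 'b::topological_space) measure)"
  by (intro borel_measurable_continuous_onI continuous_intros)

theorem theorem3:
  fixes M :: "'a measure"
    and y :: "nat \<Rightarrow> 'a \<Rightarrow> real"
    and x :: "nat \<Rightarrow> 'a \<Rightarrow> real ^ 'k"
    and const :: 'k
    and B :: "(real ^ 'k) set"
    and \<beta>\<^sub>o :: "real ^ 'k"
    and \<beta>hat :: "nat \<Rightarrow> 'a \<Rightarrow> real ^ 'k"
    and Vhat :: "nat \<Rightarrow> 'a \<Rightarrow> real ^ 'k ^ 'k"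
  assumes M: "prob_space M"
    and iid: "iid_seq M (\<lambda>i \<omega>. (y i \<omega>, x i \<omega>))"
    and binary: "\<And>i \<omega>. \<omega> \<in> space M \<Longrightarrow> y i \<omega> \<in> {0, 1}"
    and intercept: "\<And>i \<omega>. \<omega> \<in> space M \<Longrightarrow> x i \<omega> $ const = 1"
    and B_compact: "compact B"
    and \<beta>\<^sub>o_in: "\<beta>\<^sub>o \<in> B"
    and pseudo_true: "\<And>\<beta>. \<beta> \<in> B \<Longrightarrow> \<beta> \<noteq> \<beta>\<^sub>o \<Longrightarrow> Q_pop M (y 0) (x 0) \<beta>\<^sub>o < Q_pop M (y 0) (x 0) \<beta>"
    and \<beta>hat_measurable: "\<And>N. N > 0 \<Longrightarrow> \<beta>hat N \<in> borel_measurable M"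
    and \<beta>hat_in: "\<And>N \<omega>. N > 0 \<Longrightarrow> \<omega> \<in> space M \<Longrightarrow> \<beta>hat N \<omega> \<in> B"
    and \<beta>hat_min: "\<And>N \<omega> \<beta>. N > 0 \<Longrightarrow> \<omega> \<in> space M \<Longrightarrow> \<beta> \<in> B \<Longrightarrow>
          Q_sample y x N \<omega> (\<beta>hat N \<omega>) \<le> Q_sample y x N \<omega> \<beta>"
    and interior: "\<beta>\<^sub>o \<in> interior B"
    and continuous_regressor:
          "\<exists>j. continuously_distributed M (\<lambda>\<omega>. x 0 \<omega> $ j) \<and> \<beta>\<^sub>o $ j \<noteq> 0"
    and continuous_index: "continuously_distributed M (\<lambda>\<omega>. x 0 \<omega> \<bullet> \<beta>\<^sub>o)"
    and second_moment: "integrable M (\<lambda>\<omega>. norm (x 0 \<omega>) ^ 2)"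
    and A_pos_definite: "pos_definite (A_pop M (x 0) \<beta>\<^sub>o)"
    and fourth_moment: "integrable M (\<lambda>\<omega>. norm (x 0 \<omega>) ^ 4)"
    and Vhat_measurable: "\<And>N. N > 0 \<Longrightarrow> Vhat N \<in> borel_measurable M"
    and Vhat: "\<And>N \<omega>. N > 0 \<Longrightarrow> \<omega> \<in> space M \<Longrightarrow> invertible (A_sample x N \<omega> (\<beta>hat N \<omega>)) \<Longrightarrow>
          Vhat N \<omega> = sandwich (A_sample x N \<omega> (\<beta>hat N \<omega>)) (Omega_sample y x N \<omega> (\<beta>hat N \<omega>))"
  shows "converges_in_prob M Vhat
           (sandwich (A_pop M (x 0) \<beta>\<^sub>o) (Omega_pop M (y 0) (x 0) \<beta>\<^sub>o))"
proof (rule finite_measure.converges_in_prob_if_tendsto_whp)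
  interpret prob_space M by (rule M)
  show "finite_measure M" by (rule finite_measure_axioms)
  \<comment> \<open>Response and regressors are kept as one variable, since it is the pairs that are
    independent and identically distributed.\<close>
  define Z where "Z i \<omega> = (y i \<omega>, x i \<omega>)" for i \<omega>
  have iid: "iid_seq M Z" using iid unfolding Z_def[abs_def] .
  note [measurable] = iid_seq_measurable[OF iid]
  have x_meas[measurable]: "x i \<in> borel_measurable M" for i
    using measurable_compose[OF iid_seq_measurable[OF iid, of i] borel_measurable_snd]
    by (simp add: Z_def)
  have y_meas[measurable]: "y i \<in> borel_measurable M" for i
    using measurable_compose[OF iid_seq_measurable[OF iid, of i] borel_measurable_fst]
    by (simp add: Z_def)
  define q where "q z b = (fst z - ramp (snd z \<bullet> b))\<^sup>2" for z :: "real \<times> (real ^ 'k)" and b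
  define a where "a z b = A_summand (snd z) b" for z :: "real \<times> (real ^ 'k)" and b
  define w where "w z b = Omega_summand (fst z) (snd z) b" for z :: "real \<times> (real ^ 'k)" and b
  define D where "D n = modulus \<beta>\<^sub>o (inverse (real (Suc n)))" for n
  define T where "T p = \<beta>hat (fst p) (snd p)" for p
  have q_meas: "(\<lambda>z. q z b) \<in> borel_measurable borel" for b
    unfolding q_def borel_prod[symmetric] by measurable
  have a_meas: "(\<lambda>z. a z b) \<in> borel_measurable borel" for b
    unfolding a_def A_summand_def borel_prod[symmetric] by measurable
  have w_meas: "(\<lambda>z. w z b) \<in> borel_measurable borel" for b
    unfolding w_def Omega_summand_def borel_prod[symmetric] by measurable
  have q_bounds: "q (Z i \<omega>) b \<in> {0..1}" if "\<omega> \<in> space M" for i \<omega> b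
    using square_residual_bounds[OF binary[OF that]] by (simp add: q_def Z_def)
  have q_diff: "\<bar>q (Z i \<omega>) s - q (Z i \<omega>) t\<bar> \<le> 2 * \<bar>x i \<omega> \<bullet> s - x i \<omega> \<bullet> t\<bar>"
    if "\<omega> \<in> space M" for i \<omega> s t
    using square_residual_lipschitz[OF binary[OF that]] by (simp add: q_def Z_def)
  \<comment> \<open>The shared moment condition for the envelope and both matrix summands: the
    square of such a function is at most \<open>4 * norm (x 0 \<omega>) ^ 4\<close>.\<close>
  have fourth: "integrable M (\<lambda>\<omega>. (f (Z 0 \<omega>))\<^sup>2)"
    if [measurable]: "f \<in> borel_measurable borel"
      and f: "\<And>\<omega>. \<omega> \<in> space M \<Longrightarrow> \<bar>f (Z 0 \<omega>)\<bar> \<le> 2 * (norm (x 0 \<omega>))\<^sup>2" for f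
  proof (rule Bochner_Integration.integrable_bound)
    show "integrable M (\<lambda>\<omega>. 4 * norm (x 0 \<omega>) ^ 4)"
      using fourth_moment by simp
    have "(f (Z 0 \<omega>))\<^sup>2 \<le> 4 * norm (x 0 \<omega>) ^ 4" if "\<omega> \<in> space M" for \<omega>
    proof -
      have "(f (Z 0 \<omega>))\<^sup>2 \<le> (2 * (norm (x 0 \<omega>))\<^sup>2)\<^sup>2"
        using power_mono[OF f[OF that], of 2] by simp
      then show ?thesis by (simp add: power_mult_distrib)
    qed
    then show "AE \<omega> in M. norm ((f (Z 0 \<omega>))\<^sup>2) \<le> norm (4 * norm (x 0 \<omega>) ^ 4)"
      by auto
  qed measurable
  have T_lim: "(T \<longlongrightarrow> \<beta>\<^sub>o) (whp M)"
  \<comment> \<open>The random Lipschitz constant is \<open>2 * norm x\<close>, by Cauchy-Schwarz;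
    its square is integrable by the second moment.\<close>
  proof (rule M_estimator_consistent[OF iid q_meas _ _ _ _ B_compact \<beta>\<^sub>o_in])
    show "(\<lambda>z. 2 * norm (snd z)) \<in> borel_measurable (borel :: (real \<times> (real ^ 'k)) measure)"
      unfolding borel_prod[symmetric] by measurable
    show "integrable M (\<lambda>\<omega>. (q (Z 0 \<omega>) t)\<^sup>2)" for t
      using q_meas[measurable] q_bounds
      by (intro integrable_const_bound[of _ 1]) (auto intro!: AE_I2 power_le_one)
    show "integrable M (\<lambda>\<omega>. (2 * norm (snd (Z 0 \<omega>)))\<^sup>2)"
      using second_moment by (simp add: Z_def power_mult_distrib)
    show "\<bar>q (Z i \<omega>) s - q (Z i \<omega>) t\<bar> \<le> 2 * norm (snd (Z i \<omega>)) * dist s t"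
      if "\<omega> \<in> space M" for i \<omega> s t
      using q_diff[OF that, of i s t] Cauchy_Schwarz_ineq2[of "x i \<omega>" "s - t"]
      by (simp add: Z_def dist_norm inner_diff_right)
    show "expectation (\<lambda>\<omega>. q (Z 0 \<omega>) \<beta>\<^sub>o) < expectation (\<lambda>\<omega>. q (Z 0 \<omega>) t)"
      if "t \<in> B" "t \<noteq> \<beta>\<^sub>o" for t
      using pseudo_true[OF that] by (simp add: Q_pop_def q_def Z_def)
    show "\<forall>\<^sub>F p in whp M. T p \<in> B"
      using eventually_whp_space by eventually_elim (simp add: T_def \<beta>hat_in)
    show "\<forall>\<^sub>F p in whp M. sample_mean Z (\<lambda>z. q z (T p)) p \<le> sample_mean Z (\<lambda>z. q z \<beta>\<^sub>o) p"
      using eventually_whp_space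
    proof eventually_elim
      case (elim p)
      then show ?case
        using \<beta>hat_min[of "fst p" "snd p" \<beta>\<^sub>o] \<beta>\<^sub>o_in
        by (simp add: Q_sample_def sample_mean_def q_def Z_def T_def)
    qed
  qed
  have D_meas: "D n \<in> borel_measurable borel" for n
    unfolding D_def by measurable
  have D_bounds: "0 \<le> D n z" "D n z \<le> 2 * (norm (snd z))\<^sup>2" for n z
    unfolding D_def by (rule modulus_bounds; simp)+
  have D_sq: "integrable M (\<lambda>\<omega>. (D n (Z 0 \<omega>))\<^sup>2)" for n
    using D_bounds[of n "(y 0 \<omega>, x 0 \<omega>)" for \<omega>] by (intro fourth D_meas) (simp add: Z_def)
  \<comment> \<open>Dominated convergence: almost surely the index at \<open>\<beta>\<^sub>o\<close>
    avoids both kinks, and there the envelope tends to 0 pointwise.\<close>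
  have D_lim: "(\<lambda>n. expectation (\<lambda>\<omega>. D n (Z 0 \<omega>))) \<longlonglongrightarrow> 0"
  proof -
    have "(\<lambda>n. expectation (\<lambda>\<omega>. D n (Z 0 \<omega>))) \<longlonglongrightarrow> expectation (\<lambda>_. 0)"
    proof (rule integral_dominated_convergence)
      show "integrable M (\<lambda>\<omega>. 2 * (norm (x 0 \<omega>))\<^sup>2)"
        using second_moment by simp
      have "AE \<omega> in M. x 0 \<omega> \<bullet> \<beta>\<^sub>o \<noteq> c" for c
        by (intro continuously_distributed_AE_neq continuous_index) measurable
      from this[of 0] this[of 1] show "AE \<omega> in M. (\<lambda>n. D n (Z 0 \<omega>)) \<longlonglongrightarrow> 0"
        unfolding D_def by eventually_elim (rule modulus_tendsto_0; simp add: Z_def)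
      show "AE \<omega> in M. norm (D n (Z 0 \<omega>)) \<le> 2 * (norm (x 0 \<omega>))\<^sup>2" for n
        using D_bounds[of n "(y 0 \<omega>, x 0 \<omega>)" for \<omega>] by (simp add: Z_def)
      show "(\<lambda>\<omega>. D n (Z 0 \<omega>)) \<in> borel_measurable M" for n
        using D_meas[measurable] by measurable
    qed simp
    then show ?thesis by simp
  qed
  have gram_bound: "norm ((s * indicat_real {0<..<1} u) *\<^sub>R gram v) \<le> 2 * (norm v)\<^sup>2"
    if "s \<in> {0..1}" for s u and v :: "real ^ 'k"
  proof -
    have "\<bar>s * indicat_real {0<..<1} u\<bar> * (norm v)\<^sup>2 \<le> 2 * (norm v)\<^sup>2"
      using that by (intro mult_right_mono) (auto simp: indicator_def)
    then show ?thesis by (simp add: norm_gram)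
  qed
  have A_lim: "((\<lambda>p. sample_mean Z (\<lambda>z. a z (T p)) p) \<longlongrightarrow> expectation (\<lambda>\<omega>. a (Z 0 \<omega>) \<beta>\<^sub>o)) (whp M)"
  proof (rule sample_mean_plug_in_tendsto[OF iid a_meas _ D_meas D_sq D_lim _ _ T_lim])
    show "integrable M (\<lambda>\<omega>. (norm (a (Z 0 \<omega>) \<beta>\<^sub>o))\<^sup>2)"
    proof (rule fourth[of "\<lambda>z. norm (a z \<beta>\<^sub>o)"])
      show "(\<lambda>z. norm (a z \<beta>\<^sub>o)) \<in> borel_measurable borel"
        using a_meas[measurable] by measurable
      show "\<bar>norm (a (Z 0 \<omega>) \<beta>\<^sub>o)\<bar> \<le> 2 * (norm (x 0 \<omega>))\<^sup>2" for \<omega>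
        using gram_bound[of 1 "x 0 \<omega> \<bullet> \<beta>\<^sub>o" "x 0 \<omega>"] by (simp add: a_def A_summand_def Z_def)
    qed
    \<comment> \<open>With both weights equal to 1, the Lipschitz requirement on the weights is
      trivial.\<close>
    show "norm (a (Z i \<omega>) t - a (Z i \<omega>) \<beta>\<^sub>o) \<le> D n (Z i \<omega>)"
      if "\<omega> \<in> space M" "dist t \<beta>\<^sub>o < inverse (real (Suc n))" for n i \<omega> t
      using norm_scaled_gram_diff_le_modulus[of 1 1 "x i \<omega>" t \<beta>\<^sub>o] that
      by (simp add: a_def A_summand_def Z_def D_def)
  qed simp
  have W_lim: "((\<lambda>p. sample_mean Z (\<lambda>z. w z (T p)) p) \<longlongrightarrow> expectation (\<lambda>\<omega>. w (Z 0 \<omega>) \<beta>\<^sub>o)) (whp M)"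
  proof (rule sample_mean_plug_in_tendsto[OF iid w_meas _ D_meas D_sq D_lim _ _ T_lim])
    have w_eq: "w (Z i \<omega>) t = (q (Z i \<omega>) t * indicat_real {0<..<1} (x i \<omega> \<bullet> t)) *\<^sub>R gram (x i \<omega>)" for i \<omega> t
      by (simp add: w_def Omega_summand_def q_def Z_def)
    show "integrable M (\<lambda>\<omega>. (norm (w (Z 0 \<omega>) \<beta>\<^sub>o))\<^sup>2)"
    proof (rule fourth[of "\<lambda>z. norm (w z \<beta>\<^sub>o)"])
      show "(\<lambda>z. norm (w z \<beta>\<^sub>o)) \<in> borel_measurable borel"
        using w_meas[measurable] by measurable
      show "\<bar>norm (w (Z 0 \<omega>) \<beta>\<^sub>o)\<bar> \<le> 2 * (norm (x 0 \<omega>))\<^sup>2" if "\<omega> \<in> space M" for \<omega>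
        unfolding w_eq abs_norm_cancel by (intro gram_bound q_bounds that)
    qed
    \<comment> \<open>Here the weights are the squared residuals at \<open>t\<close> and
      \<open>\<beta>\<^sub>o\<close>, which lie in the unit interval and are Lipschitz in the
      index.\<close>
    show "norm (w (Z i \<omega>) t - w (Z i \<omega>) \<beta>\<^sub>o) \<le> D n (Z i \<omega>)"
      if "\<omega> \<in> space M" "dist t \<beta>\<^sub>o < inverse (real (Suc n))" for n i \<omega> t
      unfolding w_eq D_def
      using norm_scaled_gram_diff_le_modulus[OF q_diff q_bounds q_bounds, OF that(1,1,1,2)]
      by (simp add: Z_def)
  qed simp
  have A_inv: "invertible (expectation (\<lambda>\<omega>. a (Z 0 \<omega>) \<beta>\<^sub>o))"
    using pos_definite_invertible[OF A_pos_definite] by (simp add: A_pop_def a_def Z_def)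
  have "((\<lambda>p. sandwich (sample_mean Z (\<lambda>z. a z (T p)) p) (sample_mean Z (\<lambda>z. w z (T p)) p)) \<longlongrightarrow>
      sandwich (A_pop M (x 0) \<beta>\<^sub>o) (Omega_pop M (y 0) (x 0) \<beta>\<^sub>o)) (whp M)"
    using tendsto_sandwich_matrix[OF A_lim W_lim A_inv]
    by (simp add: A_pop_def Omega_pop_def a_def w_def Z_def)
  then show "((\<lambda>p. Vhat (fst p) (snd p)) \<longlongrightarrow>
      sandwich (A_pop M (x 0) \<beta>\<^sub>o) (Omega_pop M (y 0) (x 0) \<beta>\<^sub>o)) (whp M)"
  \<comment> \<open>\<open>Vhat\<close> is tied to the sandwich only where the sample matrix is
    invertible. This holds off events of vanishing probability, so its values elsewhere do not
    affect the limit.\<close>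
  proof (rule Lim_transform_eventually)
    show "\<forall>\<^sub>F p in whp M. sandwich (sample_mean Z (\<lambda>z. a z (T p)) p)
        (sample_mean Z (\<lambda>z. w z (T p)) p) = Vhat (fst p) (snd p)"
      using eventually_whp_space eventually_invertible[OF A_lim A_inv]
    proof eventually_elim
      case (elim p)
      then show ?case
        using Vhat[of "fst p" "snd p"]
        by (simp add: A_sample_def Omega_sample_def sample_mean_def a_def w_def Z_def T_def)
    qed
  qed
qed

end
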